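(* For all non-negative integers $n,n',m,m',p,q$ and all complex numbers $z,z',w,w',\gamma$, $$H_{n+n',m+m'}^{(p,q)}(z,w|\gamma)=\sum_{i=0}^{n}\sum_{j=0}^{n'}\sum_{k=0}^{m}\sum_{l=0}^{m'}\binom{n}{i}\binom{n'}{j}\binom{m}{k}\binom{m'}{l}(z-z')^{i+j}(w-w')^{k+l}H_{n+n'-i-j,\,m+m'-k-l}^{(p,q)}(z',w'|\gamma).$$
   Context: For non-negative integers $n,m,p,q$ and complex $z,w,\gamma$, $$H_{n,m}^{(p,q)}(z,w|\gamma)= n!\,m!\sum_{k=0}^{\lfloor n/p\rfloor\wedge\lfloor m/q\rfloor}\frac{\gamma^k}{k!}\frac{z^{n-pk}}{(n-pk)!}\frac{w^{m-qk}}{(m-qk)!},$$ where $a\wedge b=\min\{a,b\}$ and $\lfloor j/0\rfloor=+\infty$ by convention (so for $p=q=0$ the sum is the infinite series $e^{\gamma}z^nw^m$); $0^0=1$. *)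

theory Defs
  imports Complex_Main "HOL-Library.Extended_Nat" "HOL-Analysis.Infinite_Sum"
begin

text \<open>The convention that the floor of j/0 is infinite differs from \<open>j div 0 = 0\<close>.\<close>

definition floor_div :: "nat \<Rightarrow> nat \<Rightarrow> enat" where
  "floor_div j p = (if p = 0 then \<infinity> else enat (j div p))"

text \<open>The index set is finite unless \<open>p = q = 0\<close>, in which case it is all of the naturals and
  the sum is a genuine (absolutely convergent) series; \<open>infsum\<close> covers both cases.\<close>

definition H :: "nat \<Rightarrow> nat \<Rightarrow> nat \<Rightarrow> nat \<Rightarrow> complex \<Rightarrow> complex \<Rightarrow> complex \<Rightarrow> complex" where
  "H p q n m z w \<gamma> = fact n * fact m *
     (\<Sum>\<^sub>\<infinity>k\<in>{k. enat k \<le> min (floor_div n p) (floor_div m q)}.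
        \<gamma> ^ k / fact k * (z ^ (n - p * k) / fact (n - p * k)) * (w ^ (m - q * k) / fact (m - q * k)))"

lemma le_floor_div_iff: "enat k \<le> floor_div j p \<longleftrightarrow> p * k \<le> j"
proof (cases "p = 0")
  case False
  then show ?thesis
    using less_eq_div_iff_mult_less_eq[of p k j] by (simp add: floor_div_def mult.commute)
qed (simp add: floor_div_def)

lemma H_index_set:
  "{k. enat k \<le> min (floor_div n p) (floor_div m q)} = {k. p * k \<le> n \<and> q * k \<le> m}"
  by (simp only: min.bounded_iff le_floor_div_iff)

lemma H_finite:
  assumes "p > 0 \<or> q > 0"
  shows "H p q n m z w \<gamma> = fact n * fact m *
     (\<Sum>k | p * k \<le> n \<and> q * k \<le> m.
        \<gamma> ^ k / fact k * (z ^ (n - p * k) / fact (n - p * k)) * (w ^ (m - q * k) / fact (m - q * k)))"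
proof -
  have "{k. p * k \<le> n \<and> q * k \<le> m} \<subseteq> {..n + m}"
  proof
    fix k assume "k \<in> {k. p * k \<le> n \<and> q * k \<le> m}"
    then have "p * k \<le> n" "q * k \<le> m" by simp_all
    moreover have "k \<le> p * k \<or> k \<le> q * k" using assms by auto
    ultimately have "k \<le> n + m" by linarith
    then show "k \<in> {..n + m}" by simp
  qed
  then have "finite {k. p * k \<le> n \<and> q * k \<le> m}"
    by (rule finite_subset) simp
  then show ?thesis
    unfolding H_def H_index_set by (simp only: infsum_finite)
qed

lemma H_0_0: "H 0 0 n m z w \<gamma> = exp \<gamma> * z ^ n * w ^ m"
proof -
  have eq: "\<gamma> ^ k /\<^sub>R fact k = \<gamma> ^ k / fact k" for k
    by (simp add: scaleR_conv_of_real divide_inverse mult.commute)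
  have "((\<lambda>k. \<gamma> ^ k / fact k) has_sum exp \<gamma>) UNIV"
    using norm_summable_imp_has_sum[OF summable_norm_exp exp_converges, of \<gamma>] unfolding eq .
  from has_sum_cmult_left[OF this, of "z ^ n / fact n * (w ^ m / fact m)"]
  have "(\<Sum>\<^sub>\<infinity>k. \<gamma> ^ k / fact k * (z ^ n / fact n) * (w ^ m / fact m))
      = exp \<gamma> * (z ^ n / fact n * (w ^ m / fact m))"
    by (intro infsumI) (simp only: mult.assoc)
  moreover have "{k. 0 * k \<le> n \<and> 0 * k \<le> m} = UNIV"
    by simp
  moreover have "fact n * fact m * (exp \<gamma> * (z ^ n / fact n * (w ^ m / fact m))) =
      exp \<gamma> * z ^ n * w ^ m"
    by simp
  ultimately show ?thesis
    unfolding H_def H_index_set by (simp only: mult_0 diff_zero)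
qed

end

theory Submission imports Defs begin

text \<open>In each variable \<open>H\<close> is a linear combination of derivatives of \<open>z\<^sup>n\<close>, with coefficients
  that do not depend on \<open>n\<close>. Taylor's formula for the derivatives of \<open>z\<^sup>n\<close> therefore gives the
  addition formula with a single sum over \<open>s\<close> up to \<open>n + n'\<close> in place of the sums over \<open>i\<close> and \<open>j\<close>,
  and Vandermonde's convolution splits the single sum into the double one.\<close>

text \<open>The \<open>r\<close>-th derivative of \<open>z\<^sup>n\<close>; it is \<open>0\<close> for \<open>r > n\<close> because of the binomial coefficient.\<close>

definition power_deriv :: "nat \<Rightarrow> nat \<Rightarrow> complex \<Rightarrow> complex" where
  "power_deriv n r z = fact r * of_nat (n choose r) * z ^ (n - r)"

lemma power_deriv_eq_0: "n < r \<Longrightarrow> power_deriv n r z = 0"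
  by (simp add: power_deriv_def)

lemma power_deriv_le: "r \<le> n \<Longrightarrow> power_deriv n r z = fact n * (z ^ (n - r) / fact (n - r))"
  by (simp add: power_deriv_def binomial_fact)

text \<open>Terms with \<open>s > n - r\<close> vanish. In the others, exchanging the order of the
  two choices, of \<open>s\<close> and of \<open>r\<close> elements, pulls out
  \<open>n choose r\<close> and leaves the binomial expansion of
  \<open>((z - z') + z') ^ (n - r)\<close>.\<close>

lemma power_deriv_taylor:
  "power_deriv n r z = (\<Sum>s\<le>n. of_nat (n choose s) * (z - z') ^ s * power_deriv (n - s) r z')"
proof (cases "r \<le> n")
  case True
  have "(\<Sum>s\<le>n. of_nat (n choose s) * (z - z') ^ s * power_deriv (n - s) r z')
      = (\<Sum>s\<le>n - r. of_nat (n choose s) * (z - z') ^ s * power_deriv (n - s) r z')"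
    by (intro sum.mono_neutral_right) (auto intro!: power_deriv_eq_0)
  also have "\<dots> = (\<Sum>s\<le>n - r. fact r * of_nat (n choose r) *
      (of_nat ((n - r) choose s) * (z - z') ^ s * z' ^ (n - r - s)))"
  proof (intro sum.cong refl)
    fix s assume s: "s \<in> {..n - r}"
    have "(n choose s) * ((n - s) choose r) = (n choose r) * ((n - r) choose s)"
    proof -
      \<comment> \<open>Over the complex numbers both products become n! / (s! r! (n-r-s)!).\<close>
      have "of_nat ((n choose s) * ((n - s) choose r)) =
          (of_nat ((n choose r) * ((n - r) choose s)) :: complex)"
        using s True by (simp add: binomial_fact diff_commute add.commute)
      then show ?thesis by (simp only: of_nat_eq_iff)
    qed
    then have "of_nat (n choose s) * of_nat ((n - s) choose r) =
        (of_nat (n choose r) * of_nat ((n - r) choose s) :: complex)"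
      by (metis of_nat_mult)
    then have "of_nat (n choose s) * of_nat ((n - s) choose r) *
          (fact r * (z - z') ^ s * z' ^ (n - r - s)) =
        of_nat (n choose r) * of_nat ((n - r) choose s) *
          (fact r * (z - z') ^ s * z' ^ (n - r - s))"
      by (rule arg_cong)
    then show "of_nat (n choose s) * (z - z') ^ s * power_deriv (n - s) r z' =
        fact r * of_nat (n choose r) *
        (of_nat ((n - r) choose s) * (z - z') ^ s * z' ^ (n - r - s))"
      by (simp only: power_deriv_def diff_commute[of n s r] mult_ac)
  qed
  also have "\<dots> = power_deriv n r z"
    using binomial_ring[of "z - z'" z' "n - r"]
    by (simp add: power_deriv_def sum_distrib_left)
  finally show ?thesis ..
qed (simp add: power_deriv_eq_0)

text \<open>Pascal's rule splits the left side into two sums. The one without the shift regains its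
  term \<open>f 0\<close>, and its top term vanishes since \<open>n choose Suc n\<close> is
  0.\<close>

lemma sum_binomial_Suc:
  fixes f :: "nat \<Rightarrow> 'a::comm_semiring_1"
  shows "(\<Sum>i\<le>Suc n. of_nat (Suc n choose i) * f i) =
    (\<Sum>i\<le>n. of_nat (n choose i) * (f i + f (Suc i)))"
proof -
  have "(\<Sum>i\<le>Suc n. of_nat (Suc n choose i) * f i) =
      (f 0 + (\<Sum>i\<le>n. of_nat (n choose Suc i) * f (Suc i))) +
      (\<Sum>i\<le>n. of_nat (n choose i) * f (Suc i))"
    by (subst sum.atMost_Suc_shift) (simp add: algebra_simps sum.distrib)
  also have "f 0 + (\<Sum>i\<le>n. of_nat (n choose Suc i) * f (Suc i)) =
      (\<Sum>i\<le>Suc n. of_nat (n choose i) * f i)"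
    by (simp del: sum.atMost_Suc add: sum.atMost_Suc_shift)
  also have "\<dots> = (\<Sum>i\<le>n. of_nat (n choose i) * f i)"
    by (simp add: binomial_eq_0)
  finally show ?thesis
    by (simp add: algebra_simps sum.distrib)
qed

text \<open>Vandermonde's convolution, tested against an arbitrary \<open>f\<close>. The induction
  needs \<open>f\<close> arbitrary because its step passes to
  \<open>f s + f (Suc s)\<close>.\<close>

lemma sum_binomial_add:
  fixes f :: "nat \<Rightarrow> 'a::comm_semiring_1"
  shows "(\<Sum>s\<le>n + n'. of_nat ((n + n') choose s) * f s) =
    (\<Sum>i\<le>n. of_nat (n choose i) * (\<Sum>j\<le>n'. of_nat (n' choose j) * f (i + j)))"
proof (induction n arbitrary: f)
  case (Suc n)
  have "(\<Sum>s\<le>Suc n + n'. of_nat ((Suc n + n') choose s) * f s) =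
      (\<Sum>s\<le>n + n'. of_nat ((n + n') choose s) * (f s + f (Suc s)))"
    by (simp only: add_Suc sum_binomial_Suc)
  also have "\<dots> = (\<Sum>i\<le>n. of_nat (n choose i) *
      (\<Sum>j\<le>n'. of_nat (n' choose j) * (f (i + j) + f (Suc (i + j)))))"
    by (rule Suc.IH)
  also have "\<dots> = (\<Sum>i\<le>Suc n. of_nat (Suc n choose i) *
      (\<Sum>j\<le>n'. of_nat (n' choose j) * f (i + j)))"
    by (subst sum_binomial_Suc) (simp add: distrib_left sum.distrib)
  finally show ?case .
qed simp

text \<open>The bounds \<open>N\<close> and \<open>M\<close> allow one index set and one coefficient
  family for all the \<open>n\<close>, \<open>m\<close>, \<open>z\<close>, \<open>w\<close> at once,
  so that the values of \<open>H\<close> in the addition formula can be combined termwise.\<close>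

lemma H_eq_sum_power_deriv:
  obtains c :: "nat \<Rightarrow> complex" and A :: "nat set" where
    "\<And>n m z w. n \<le> N \<Longrightarrow> m \<le> M \<Longrightarrow>
      H p q n m z w \<gamma> = (\<Sum>k\<in>A. c k * (power_deriv n (p * k) z * power_deriv m (q * k) w))"
proof (cases "p > 0 \<or> q > 0")
  case True
  show thesis
  proof (rule that)
    fix n m z w assume le: "n \<le> N" "m \<le> M"
    have sub: "{k. p * k \<le> n \<and> q * k \<le> m} \<subseteq> {..N + M}"
    proof
      fix k assume "k \<in> {k. p * k \<le> n \<and> q * k \<le> m}"
      then have "p * k \<le> n" "q * k \<le> m" by simp_all
      moreover have "k \<le> p * k \<or> k \<le> q * k" using True by auto
      ultimately have "k \<le> N + M" using le by linarith
      then show "k \<in> {..N + M}" by simp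
    qed
    have "H p q n m z w \<gamma> = (\<Sum>k | p * k \<le> n \<and> q * k \<le> m.
        \<gamma> ^ k / fact k * (power_deriv n (p * k) z * power_deriv m (q * k) w))"
      unfolding H_finite[OF True] sum_distrib_left
      by (intro sum.cong) (simp_all add: power_deriv_le mult_ac)
    also have "\<dots> = (\<Sum>k\<in>{..N + M}.
        \<gamma> ^ k / fact k * (power_deriv n (p * k) z * power_deriv m (q * k) w))"
      \<comment> \<open>Each added \<open>k\<close> has a derivative of order above the exponent, so
        its term is 0.\<close>
      using sub by (intro sum.mono_neutral_left) (auto simp: not_le power_deriv_eq_0)
    finally show "H p q n m z w \<gamma> = (\<Sum>k\<in>{..N + M}.
        \<gamma> ^ k / fact k * (power_deriv n (p * k) z * power_deriv m (q * k) w))" .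
  qed
next
  case False
  show thesis
    \<comment> \<open>Here \<open>p = q = 0\<close>: only derivatives of order 0 occur, and the
      series in \<gamma> collapses to the single coefficient \<open>exp \<gamma>\<close>.\<close>
    by (rule that[of "\<lambda>_. exp \<gamma>" "{0}"]) (use False in \<open>simp add: H_0_0 power_deriv_def\<close>)
qed

lemma H_taylor:
  "H p q n m z w \<gamma> = (\<Sum>s\<le>n. of_nat (n choose s) * (\<Sum>t\<le>m. of_nat (m choose t) *
    ((z - z') ^ s * (w - w') ^ t * H p q (n - s) (m - t) z' w' \<gamma>)))"
proof -
  obtain c :: "nat \<Rightarrow> complex" and A where H:
    "\<And>n' m' z w. n' \<le> n \<Longrightarrow> m' \<le> m \<Longrightarrow>
      H p q n' m' z w \<gamma> = (\<Sum>k\<in>A. c k * (power_deriv n' (p * k) z * power_deriv m' (q * k) w))"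
    using H_eq_sum_power_deriv[where N = n and M = m and p = p and q = q and \<gamma> = \<gamma>] by blast
  have "H p q n m z w \<gamma> = (\<Sum>k\<in>A. \<Sum>s\<le>n. \<Sum>t\<le>m. c k *
      ((of_nat (n choose s) * (z - z') ^ s * power_deriv (n - s) (p * k) z') *
       (of_nat (m choose t) * (w - w') ^ t * power_deriv (m - t) (q * k) w')))"
    unfolding H[OF order_refl order_refl] power_deriv_taylor[of n _ z z']
      power_deriv_taylor[of m _ w w'] sum_product
    by (simp only: sum_distrib_left)
  also have "\<dots> = (\<Sum>s\<le>n. \<Sum>t\<le>m. \<Sum>k\<in>A. c k *
      ((of_nat (n choose s) * (z - z') ^ s * power_deriv (n - s) (p * k) z') *
       (of_nat (m choose t) * (w - w') ^ t * power_deriv (m - t) (q * k) w')))"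
    by (subst sum.swap, rule sum.cong[OF refl], rule sum.swap)
  also have "\<dots> = (\<Sum>s\<le>n. of_nat (n choose s) * (\<Sum>t\<le>m. of_nat (m choose t) *
    ((z - z') ^ s * (w - w') ^ t * H p q (n - s) (m - t) z' w' \<gamma>)))"
    \<comment> \<open>As \<open>n - s \<le> n\<close> and \<open>m - t \<le> m\<close>, the same
      \<open>c\<close> and \<open>A\<close> represent each \<open>H\<close> on the right.\<close>
    by (simp add: H sum_distrib_left mult_ac)
  finally show ?thesis .
qed

theorem proposition7p2:
  fixes n n' m m' p q :: nat and z z' w w' \<gamma> :: complex
  shows "H p q (n + n') (m + m') z w \<gamma> =
    (\<Sum>i=0..n. \<Sum>j=0..n'. \<Sum>k=0..m. \<Sum>l=0..m'.
       of_nat (n choose i) * of_nat (n' choose j) * of_nat (m choose k) * of_nat (m' choose l) *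
       (z - z') ^ (i + j) * (w - w') ^ (k + l) *
       H p q (n + n' - i - j) (m + m' - k - l) z' w' \<gamma>)"
  \<comment> \<open>The convolution is applied in both variables, with \<open>s = i + j\<close> and
    \<open>t = k + l\<close>.\<close>
  unfolding H_taylor[of p q "n + n'" "m + m'" z w \<gamma> z' w'] sum_binomial_add
  by (simp add: sum_distrib_left mult.assoc atLeast0AtMost)

end
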